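(* Let $G$ be an additive (abelian) group, let $K\ge1$, and let $X,Y$ be jointly distributed $G$-random variables such that $$H(X,Y)\ge H(X)+H(Y)-\log K\quad\text{and}\quad H(X+Y)\le\tfrac12H(X)+\tfrac12H(Y)+\log K.$$ Let $(X_1,X_2,Y)$ be a triple of random variables such that $(X_1,Y)$ and $(X_2,Y)$ each have the joint distribution of $(X,Y)$ and $X_1,X_2$ are conditionally independent relative to $Y$ (i.e. $\mathbb{P}(X_1=x_1,X_2=x_2,Y=y)=\mathbb{P}(X=x_1,Y=y)\mathbb{P}(X=x_2,Y=y)/\mathbb{P}(Y=y)$). Let $Y'$ be a further random variable, defined jointly with $(X_1,X_2,Y)$, such that $(X_1,Y')$ has the same joint distribution as $(X_1,Y)$ and $Y'$ is conditionally independent of $(X_2,Y)$ relative to $X_1$. Then $X_2$ and $Y'$ are conditionally independent relative to $(X_1,Y)$, and \begin{align*} H(X_2\mid X_1,Y)&\ge H(X)-\log K,\\ H(Y'\mid X_1,Y)&\ge H(Y)-\log K,\\ H(X_2+Y'\mid X_1,Y)&\le\tfrac12H(X)+\tfrac12H(Y)+7\log K. \end{align*}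
   Context: A $G$-random variable is a random variable taking values in $G$ with only finitely many values of positive probability. Entropy $H(X)=\sum_x \mathbb{P}(X=x)\log\frac1{\mathbb{P}(X=x)}$; $H(X,Y)$ is the entropy of the pair. Conditional entropy $H(X\mid W)=\sum_w\mathbb{P}(W=w)H(X\mid W=w)$ over $w$ with $\mathbb{P}(W=w)>0$. Random variables $A,B$ are conditionally independent relative to $W$ if $(A\mid W=w)$ and $(B\mid W=w)$ are independent for every such $w$. *)

theory Defs
  imports "HOL-Probability.Probability"
begin

definition rv_support :: "'w measure \<Rightarrow> ('w \<Rightarrow> 'a) \<Rightarrow> 'a set" where
  "rv_support M X = {x. \<P>(\<omega> in M. X \<omega> = x) > 0}"

(* Values are taken in a discrete space.  The last conjunct says that the finitely many atoms
   carry the whole mass; for an uncountable value type this does not follow from the other two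
   (a law on the full power set could conceivably have a diffuse part). *)
definition finite_rv :: "'w measure \<Rightarrow> ('w \<Rightarrow> 'a) \<Rightarrow> bool" where
  "finite_rv M X \<longleftrightarrow>
     X \<in> measurable M (count_space UNIV) \<and>
     finite (rv_support M X) \<and>
     (AE \<omega> in M. X \<omega> \<in> rv_support M X)"

(* The library's entropy is taken relative to a reference measure through a Radon-Nikodym
   derivative, which is not meaningful for counting measure on an uncountable set of values;
   hence the elementary sum (with natural logarithm). *)
definition shannon_entropy :: "'w measure \<Rightarrow> ('w \<Rightarrow> 'a) \<Rightarrow> real" where
  "shannon_entropy M X =
     (\<Sum>x\<in>rv_support M X. \<P>(\<omega> in M. X \<omega> = x) * ln (1 / \<P>(\<omega> in M. X \<omega> = x)))"

(* For P(W = w) > 0, the law of (X | W = w) is that of X under this measure. *)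
definition cond_measure :: "'w measure \<Rightarrow> ('w \<Rightarrow> 'c) \<Rightarrow> 'c \<Rightarrow> 'w measure" where
  "cond_measure M W w = uniform_measure M {\<omega> \<in> space M. W \<omega> = w}"

definition cond_shannon_entropy :: "'w measure \<Rightarrow> ('w \<Rightarrow> 'a) \<Rightarrow> ('w \<Rightarrow> 'c) \<Rightarrow> real" where
  "cond_shannon_entropy M X W =
     (\<Sum>w\<in>rv_support M W. \<P>(\<omega> in M. W \<omega> = w) * shannon_entropy (cond_measure M W w) X)"

(* The library's indep_var requires both variables to have the same value type, so independence is
   stated for the generated sigma-algebras, as in indep_var_eq.  Over a discrete value space these
   consist of all preimages. *)
definition indep_rvs :: "'w measure \<Rightarrow> ('w \<Rightarrow> 'a) \<Rightarrow> ('w \<Rightarrow> 'b) \<Rightarrow> bool" where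
  "indep_rvs M A B \<longleftrightarrow>
     prob_space.indep_set M (range (\<lambda>S. A -` S \<inter> space M)) (range (\<lambda>T. B -` T \<inter> space M))"

definition cond_indep :: "'w measure \<Rightarrow> ('w \<Rightarrow> 'a) \<Rightarrow> ('w \<Rightarrow> 'b) \<Rightarrow> ('w \<Rightarrow> 'c) \<Rightarrow> bool" where
  "cond_indep M A B W \<longleftrightarrow> (\<forall>w\<in>rv_support M W. indep_rvs (cond_measure M W w) A B)"

definition same_law :: "'w measure \<Rightarrow> ('w \<Rightarrow> 'a) \<Rightarrow> 'v measure \<Rightarrow> ('v \<Rightarrow> 'a) \<Rightarrow> bool" where
  "same_law M X N Y \<longleftrightarrow> distr M (count_space UNIV) X = distr N (count_space UNIV) Y"

end

theory Submission
  imports Defs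
begin

text \<open>The four variables form a Markov chain \<open>X2 - Y1 - X1 - Y'\<close>, so their joint entropy is
  \<open>3 H(X, Y) - H(X) - H(Y)\<close> and the first two conditional entropies are \<open>H(X, Y) - H(Y)\<close> and
  \<open>H(X, Y) - H(X)\<close>.  For the last bound, \<open>Z = X2 + Y'\<close> is a function both of the pair \<open>(X2, Y')\<close>
  and of the triple \<open>(X2 + Y1, X1 + Y1, X1 + Y')\<close>, as \<open>Z = (X2 + Y1) - (X1 + Y1) + (X1 + Y')\<close>,
  and the pair and the triple together determine everything.  Submodularity gives
  \<open>H(X1, X2, Y1, Y') + H(Z) \<le> 3 H(X + Y) + H(X) + H(Y)\<close>.\<close>

section \<open>Invariance of probabilities and entropies under equality of laws and
  relabelling\<close>

lemma same_law_prob: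
  assumes "X \<in> measurable M (count_space UNIV)" and "Y \<in> measurable N (count_space UNIV)"
    and "same_law M X N Y"
  shows "\<P>(\<omega> in M. X \<omega> \<in> A) = \<P>(\<omega> in N. Y \<omega> \<in> A)"
proof -
  have "measure (distr M (count_space UNIV) X) A = measure (distr N (count_space UNIV) Y) A"
    using assms(3) by (simp add: same_law_def)
  then show ?thesis
    using assms(1,2) by (simp add: measure_distr vimage_def Int_def conj_commute)
qed

lemma same_law_comp_prob:
  assumes "X \<in> measurable M (count_space UNIV)" and "Y \<in> measurable N (count_space UNIV)"
    and "same_law M X N Y"
  shows "\<P>(\<omega> in M. f (X \<omega>) = a) = \<P>(\<omega> in N. f (Y \<omega>) = a)"
  using same_law_prob[OF assms, of "f -` {a}"] by simp

text \<open>Entropy depends only on point probabilities. Because \<open>f\<close> is free, one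
  equality of pair laws yields the entropies of both marginals, of the swapped pair and of the sum
  of the coordinates.\<close>

lemma same_law_shannon_entropy:
  assumes "X \<in> measurable M (count_space UNIV)" and "Y \<in> measurable N (count_space UNIV)"
    and "same_law M X N Y"
  shows "shannon_entropy M (\<lambda>\<omega>. f (X \<omega>)) = shannon_entropy N (\<lambda>\<omega>. f (Y \<omega>))"
  unfolding shannon_entropy_def rv_support_def same_law_comp_prob[OF assms] ..

text \<open>Relabelling moves atoms without merging them, and a value outside \<open>range f\<close>
  has empty preimage. This permits regrouping of tuples and, in the last bound, an injective linear
  change of variables.\<close>

lemma shannon_entropy_inj:
  assumes "inj f"
  shows "shannon_entropy M (\<lambda>\<omega>. f (X \<omega>)) = shannon_entropy M X"
proof -
  have eq: "\<P>(\<omega> in M. f (X \<omega>) = f x) = \<P>(\<omega> in M. X \<omega> = x)" for x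
    using assms by (simp add: inj_eq)
  have "rv_support M (\<lambda>\<omega>. f (X \<omega>)) \<subseteq> range f"
  proof
    fix y assume "y \<in> rv_support M (\<lambda>\<omega>. f (X \<omega>))"
    then have "{\<omega> \<in> space M. f (X \<omega>) = y} \<noteq> {}"
      unfolding rv_support_def by (metis (lifting) less_irrefl measure_empty mem_Collect_eq)
    then show "y \<in> range f" by auto
  qed
  then have "rv_support M (\<lambda>\<omega>. f (X \<omega>)) = f ` rv_support M X"
    using eq by (auto simp: rv_support_def)
  then show ?thesis
    unfolding shannon_entropy_def
    using assms by (simp add: sum.reindex inj_on_subset eq inj_eq)
qed

context prob_space
begin

section \<open>Finitely supported variables and their images\<close>

text \<open>Any finite set of almost sure values will do: an atom outside \<open>F\<close> would
  contradict the almost sure membership, and the points of \<open>F\<close> with mass zero are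
  finitely many null events, discarded together.\<close>

lemma finite_rvI:
  assumes X: "X \<in> measurable M (count_space UNIV)" and "finite F" and "AE \<omega> in M. X \<omega> \<in> F"
  shows "finite_rv M X"
proof -
  have meas: "{\<omega> \<in> space M. X \<omega> \<in> A} \<in> events" for A
    using measurable_sets[OF X, of A] by (simp add: vimage_def Int_def conj_commute)
  have meas1: "{\<omega> \<in> space M. X \<omega> = x} \<in> events" for x
    using meas[of "{x}"] by simp
  have "rv_support M X \<subseteq> F"
  proof (rule ccontr)
    assume "\<not> rv_support M X \<subseteq> F"
    then obtain x where "x \<notin> F" and pos: "\<P>(\<omega> in M. X \<omega> = x) > 0"
      by (auto simp: rv_support_def)
    then have "AE \<omega> in M. X \<omega> \<noteq> x"
      using assms(3) by (auto elim: AE_mp)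
    then have "\<P>(\<omega> in M. X \<omega> = x) = 0"
      using meas1[of x] by (simp add: prob_Collect_eq_0)
    then show False using pos by simp
  qed
  moreover have "AE \<omega> in M. \<forall>x\<in>F - rv_support M X. X \<omega> \<noteq> x"
  proof (rule AE_finite_allI)
    fix x assume "x \<in> F - rv_support M X"
    then have "\<P>(\<omega> in M. X \<omega> = x) = 0"
      by (auto simp: rv_support_def zero_less_measure_iff not_less measure_le_0_iff)
    then show "AE \<omega> in M. X \<omega> \<noteq> x"
      using meas1[of x] by (simp add: prob_Collect_eq_0)
  qed (use assms(2) in auto)
  then have "AE \<omega> in M. X \<omega> \<in> rv_support M X"
    using assms(3) by eventually_elim auto
  ultimately show ?thesis
    using X \<open>finite F\<close> by (auto simp: finite_rv_def intro: finite_subset)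
qed

lemma finite_rv_comp:
  assumes "finite_rv M X"
  shows "finite_rv M (\<lambda>\<omega>. f (X \<omega>))"
proof (rule finite_rvI[where F = "f ` rv_support M X"])
  show "(\<lambda>\<omega>. f (X \<omega>)) \<in> measurable M (count_space UNIV)"
    using assms by (auto simp: finite_rv_def intro: measurable_compose)
  show "AE \<omega> in M. f (X \<omega>) \<in> f ` rv_support M X"
    using assms unfolding finite_rv_def by (auto elim: AE_mp)
qed (use assms in \<open>simp add: finite_rv_def\<close>)

text \<open>Almost sure membership in the support of \<open>Y\<close> is rephrased as probability
  one, a form that equality of laws carries over to \<open>X\<close>.\<close>

lemma finite_rv_same_law:
  assumes "prob_space N" and "finite_rv N Y" and "X \<in> measurable M (count_space UNIV)"
    and "same_law M X N Y"
  shows "finite_rv M X"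
proof (rule finite_rvI[where F = "rv_support N Y"])
  interpret N: prob_space N by fact
  let ?S = "rv_support N Y"
  have Y: "Y \<in> measurable N (count_space UNIV)" using assms(2) by (simp add: finite_rv_def)
  have "\<P>(\<omega> in N. Y \<omega> \<in> ?S) = 1"
    using assms(2) measurable_sets[OF Y, of ?S]
    by (subst N.prob_Collect_eq_1) (auto simp: finite_rv_def vimage_def Int_def conj_commute)
  then have "\<P>(\<omega> in M. X \<omega> \<in> ?S) = 1"
    using same_law_prob[OF assms(3) Y assms(4)] by simp
  then show "AE \<omega> in M. X \<omega> \<in> ?S"
    using measurable_sets[OF assms(3), of ?S]
    by (subst (asm) prob_Collect_eq_1) (auto simp: vimage_def Int_def conj_commute)
qed (use assms in \<open>auto simp: finite_rv_def\<close>)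

text \<open>No mass lies off the support, so the law is a finite sum of atoms even over an
  uncountable value type. The computations with images and marginals below rest on this.\<close>

lemma prob_finite_rv:
  assumes "finite_rv M Q"
  shows "\<P>(\<omega> in M. Q \<omega> \<in> A) = (\<Sum>s\<in>rv_support M Q \<inter> A. \<P>(\<omega> in M. Q \<omega> = s))"
proof (rule prob_sum)
  have Q: "Q \<in> measurable M (count_space UNIV)" using assms by (simp add: finite_rv_def)
  show "{\<omega> \<in> space M. Q \<omega> \<in> A} \<in> events"
    using measurable_sets[OF Q, of A] by (simp add: vimage_def Int_def conj_commute)
  show "{\<omega> \<in> space M. Q \<omega> = s} \<in> events" for s
    using measurable_sets[OF Q, of "{s}"] by (simp add: vimage_def Int_def conj_commute)
  have "AE \<omega> in M. Q \<omega> \<in> rv_support M Q" using assms by (simp add: finite_rv_def)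
  then show "AE \<omega> in M. (\<forall>s\<in>rv_support M Q \<inter> A. Q \<omega> = s \<longrightarrow> Q \<omega> \<in> A)
      \<and> (Q \<omega> \<in> A \<longrightarrow> (\<exists>!s. s \<in> rv_support M Q \<inter> A \<and> Q \<omega> = s))"
    by eventually_elim auto
qed (use assms in \<open>simp add: finite_rv_def\<close>)

lemma prob_comp_finite_rv:
  assumes "finite_rv M Q"
  shows "\<P>(\<omega> in M. f (Q \<omega>) = a) = (\<Sum>s | s \<in> rv_support M Q \<and> f s = a. \<P>(\<omega> in M. Q \<omega> = s))"
  using prob_finite_rv[OF assms, of "f -` {a}"] by (simp add: vimage_def Int_def)

lemma prob_support_sum:
  assumes "finite_rv M Q"
  shows "(\<Sum>s\<in>rv_support M Q. \<P>(\<omega> in M. Q \<omega> = s)) = 1"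
  using prob_finite_rv[OF assms, of UNIV] by (simp add: prob_space)

text \<open>The mass over \<open>a\<close> is the sum of the atoms of \<open>Q\<close> in the fibre
  of \<open>f\<close>: an empty sum vanishes, and a nonempty sum of positive terms is
  positive.\<close>

lemma rv_support_comp:
  assumes "finite_rv M Q"
  shows "rv_support M (\<lambda>\<omega>. f (Q \<omega>)) = f ` rv_support M Q"
proof -
  have fin: "finite (rv_support M Q)" using assms by (simp add: finite_rv_def)
  have "\<P>(\<omega> in M. f (Q \<omega>) = a) > 0 \<longleftrightarrow> a \<in> f ` rv_support M Q" for a
  proof
    assume "\<P>(\<omega> in M. f (Q \<omega>) = a) > 0"
    then have "(\<Sum>s | s \<in> rv_support M Q \<and> f s = a. \<P>(\<omega> in M. Q \<omega> = s)) \<noteq> 0"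
      using prob_comp_finite_rv[OF assms, of f a] by linarith
    then obtain s where "s \<in> rv_support M Q" "f s = a"
      by (metis (mono_tags, lifting) mem_Collect_eq sum.neutral)
    then show "a \<in> f ` rv_support M Q" by auto
  next
    assume "a \<in> f ` rv_support M Q"
    then show "\<P>(\<omega> in M. f (Q \<omega>) = a) > 0"
      unfolding prob_comp_finite_rv[OF assms]
      using fin by (intro sum_pos) (auto simp: rv_support_def)
  qed
  then show ?thesis by (auto simp: rv_support_def)
qed

section \<open>Entropy of functions of a variable, and submodularity\<close>

text \<open>The atoms of \<open>Q\<close> are grouped by their image. Entropies of several functions
  of \<open>Q\<close> thereby become sums over one index set with the same weights, and can be
  compared term by term.\<close>

lemma shannon_entropy_comp:
  assumes "finite_rv M Q"
  shows "shannon_entropy M (\<lambda>\<omega>. f (Q \<omega>)) =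
    (\<Sum>s\<in>rv_support M Q. \<P>(\<omega> in M. Q \<omega> = s) * ln (1 / \<P>(\<omega> in M. f (Q \<omega>) = f s)))"
    (is "_ = (\<Sum>s\<in>?S. ?p s * ln (1 / ?q (f s)))")
proof -
  have fin: "finite ?S" using assms by (simp add: finite_rv_def)
  have "(\<Sum>s\<in>?S. ?p s * ln (1 / ?q (f s)))
      = (\<Sum>a\<in>f ` ?S. \<Sum>s | s \<in> ?S \<and> f s = a. ?p s * ln (1 / ?q (f s)))"
    by (rule sum.image_gen[OF fin])
  also have "\<dots> = (\<Sum>a\<in>f ` ?S. (\<Sum>s | s \<in> ?S \<and> f s = a. ?p s) * ln (1 / ?q a))"
    by (auto simp: sum_distrib_right intro!: sum.cong)
  also have "\<dots> = shannon_entropy M (\<lambda>\<omega>. f (Q \<omega>))"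
    unfolding shannon_entropy_def rv_support_comp[OF assms] prob_comp_finite_rv[OF assms] ..
  finally show ?thesis ..
qed

text \<open>Bounding \<open>ln\<close> by its tangent at \<open>1\<close> reduces the claim to
  \<open>\<Sum> P(U = u) P(V = v) / P(Z = a u) \<le> 1\<close>, summed over compatible pairs \<open>(u, v)\<close>.\<close>
lemma shannon_entropy_submodular:
  assumes fin: "finite_rv M (\<lambda>\<omega>. (U \<omega>, V \<omega>))"
    and ab: "\<And>\<omega>. \<omega> \<in> space M \<Longrightarrow> a (U \<omega>) = b (V \<omega>)"
  shows "shannon_entropy M (\<lambda>\<omega>. (U \<omega>, V \<omega>)) + shannon_entropy M (\<lambda>\<omega>. a (U \<omega>))
    \<le> shannon_entropy M U + shannon_entropy M V"
proof -
  let ?S = "rv_support M (\<lambda>\<omega>. (U \<omega>, V \<omega>))"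
  define p where "p s = \<P>(\<omega> in M. (U \<omega>, V \<omega>) = s)" for s
  define pu where "pu u = \<P>(\<omega> in M. U \<omega> = u)" for u
  define pv where "pv v = \<P>(\<omega> in M. V \<omega> = v)" for v
  define pz where "pz z = \<P>(\<omega> in M. a (U \<omega>) = z)" for z
  have U: "finite_rv M U" and V: "finite_rv M V"
    using finite_rv_comp[OF fin, of fst] finite_rv_comp[OF fin, of snd] by simp_all
  have SU: "rv_support M U = fst ` ?S" and SV: "rv_support M V = snd ` ?S"
    using rv_support_comp[OF fin, of fst] rv_support_comp[OF fin, of snd] by simp_all
  have SZ: "rv_support M (\<lambda>\<omega>. a (U \<omega>)) = a ` rv_support M U"
    by (rule rv_support_comp[OF U])
  have finS: "finite ?S" using fin by (simp add: finite_rv_def)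
  have pos: "p s > 0" "pu (fst s) > 0" "pv (snd s) > 0" "pz (a (fst s)) > 0" if "s \<in> ?S" for s
  proof -
    show "p s > 0" using that by (simp add: rv_support_def p_def)
    have "fst s \<in> rv_support M U" "snd s \<in> rv_support M V"
      "a (fst s) \<in> rv_support M (\<lambda>\<omega>. a (U \<omega>))"
      using that unfolding SU SV SZ by auto
    then show "pu (fst s) > 0" "pv (snd s) > 0" "pz (a (fst s)) > 0"
      by (simp_all add: rv_support_def pu_def pv_def pz_def)
  qed
  \<comment> \<open>An event of positive probability contains a sample point, so the pointwise
    relation \<open>ab\<close> passes to the values in the support.\<close>
  have compat: "b (snd s) = a (fst s)" if "s \<in> ?S" for s
  proof -
    have "{\<omega> \<in> space M. (U \<omega>, V \<omega>) = s} \<noteq> {}"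
      using pos(1)[OF that] unfolding p_def by (metis (lifting) less_irrefl measure_empty)
    then show ?thesis using ab by auto
  qed
  have HQ: "shannon_entropy M (\<lambda>\<omega>. (U \<omega>, V \<omega>)) = (\<Sum>s\<in>?S. p s * ln (1 / p s))"
    unfolding shannon_entropy_def p_def ..
  have HU: "shannon_entropy M U = (\<Sum>s\<in>?S. p s * ln (1 / pu (fst s)))"
    using shannon_entropy_comp[OF fin, of fst] by (simp add: p_def pu_def)
  have HV: "shannon_entropy M V = (\<Sum>s\<in>?S. p s * ln (1 / pv (snd s)))"
    using shannon_entropy_comp[OF fin, of snd] by (simp add: p_def pv_def)
  have HZ: "shannon_entropy M (\<lambda>\<omega>. a (U \<omega>)) = (\<Sum>s\<in>?S. p s * ln (1 / pz (a (fst s))))"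
    using shannon_entropy_comp[OF fin, of "\<lambda>s. a (fst s)"] by (simp add: p_def pz_def)
  have "shannon_entropy M (\<lambda>\<omega>. (U \<omega>, V \<omega>)) + shannon_entropy M (\<lambda>\<omega>. a (U \<omega>))
      - (shannon_entropy M U + shannon_entropy M V)
    = (\<Sum>s\<in>?S. p s * ln (pu (fst s) * pv (snd s) / (p s * pz (a (fst s)))))"
    unfolding HQ HU HV HZ sum.distrib[symmetric] sum_subtractf[symmetric]
  proof (rule sum.cong[OF refl])
    fix s assume "s \<in> ?S"
    note pos[OF this]
    then show "p s * ln (1 / p s) + p s * ln (1 / pz (a (fst s)))
        - (p s * ln (1 / pu (fst s)) + p s * ln (1 / pv (snd s)))
      = p s * ln (pu (fst s) * pv (snd s) / (p s * pz (a (fst s))))"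
      by (simp add: ln_div ln_mult algebra_simps)
  qed
  also have "\<dots> \<le> (\<Sum>s\<in>?S. pu (fst s) * pv (snd s) / pz (a (fst s)) - p s)"
  proof (rule sum_mono)
    fix s assume "s \<in> ?S"
    note s = pos[OF this]
    let ?r = "pu (fst s) * pv (snd s) / (p s * pz (a (fst s)))"
    have "p s * ln ?r \<le> p s * (?r - 1)"
      using s by (intro mult_left_mono ln_le_minus_one) auto
    also have "\<dots> = pu (fst s) * pv (snd s) / pz (a (fst s)) - p s"
      using s by (simp add: field_simps)
    finally show "p s * ln ?r \<le> pu (fst s) * pv (snd s) / pz (a (fst s)) - p s" .
  qed
  also have "\<dots> = (\<Sum>s\<in>?S. pu (fst s) * pv (snd s) / pz (a (fst s))) - 1"
    using prob_support_sum[OF fin] by (simp add: sum_subtractf p_def)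
  \<comment> \<open>The support of the pair is enlarged to all compatible pairs of marginal values;
    the added terms are nonnegative, and the larger sum factors fibre by fibre.\<close>
  also have "(\<Sum>s\<in>?S. pu (fst s) * pv (snd s) / pz (a (fst s)))
      \<le> (\<Sum>s\<in>Sigma (rv_support M U) (\<lambda>u. {v. v \<in> rv_support M V \<and> b v = a u}).
          pu (fst s) * pv (snd s) / pz (a (fst s)))"
  proof (rule sum_mono2)
    show "?S \<subseteq> Sigma (rv_support M U) (\<lambda>u. {v. v \<in> rv_support M V \<and> b v = a u})"
      unfolding SU SV using compat by force
  qed (use finS in \<open>auto simp: SU SV pu_def pv_def pz_def\<close>)
  also have "\<dots> = (\<Sum>u\<in>rv_support M U. \<Sum>v | v \<in> rv_support M V \<and> b v = a u. pu u * pv v / pz (a u))"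
    using finS by (subst sum.Sigma) (auto simp: SU SV split_def)
  also have "\<dots> = (\<Sum>u\<in>rv_support M U. pu u)"
  proof (rule sum.cong[OF refl])
    fix u assume "u \<in> rv_support M U"
    then have "pz (a u) > 0" using pos(4) unfolding SU by auto
    \<comment> \<open>The values of \<open>V\<close> compatible with \<open>u\<close> make up the
      event \<open>b V = a u\<close>, which by \<open>ab\<close> is the event
      \<open>a U = a u\<close>; this cancels the denominator.\<close>
    have "(\<Sum>v | v \<in> rv_support M V \<and> b v = a u. pv v) = \<P>(\<omega> in M. b (V \<omega>) = a u)"
      using prob_comp_finite_rv[OF V, of b "a u"] by (simp add: pv_def)
    also have "\<dots> = pz (a u)"
      unfolding pz_def by (rule arg_cong[where f = prob]) (use ab in auto)
    finally show "(\<Sum>v | v \<in> rv_support M V \<and> b v = a u. pu u * pv v / pz (a u)) = pu u"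
      using \<open>pz (a u) > 0\<close> by (simp add: sum_divide_distrib[symmetric] sum_distrib_left[symmetric])
  qed
  also have "\<dots> = 1" using prob_support_sum[OF U] by (simp add: pu_def)
  finally show ?thesis by simp
qed

text \<open>Submodularity with a constant common function, whose entropy is zero.\<close>

lemma shannon_entropy_subadditive:
  assumes "finite_rv M (\<lambda>\<omega>. (U \<omega>, V \<omega>))"
  shows "shannon_entropy M (\<lambda>\<omega>. (U \<omega>, V \<omega>)) \<le> shannon_entropy M U + shannon_entropy M V"
proof -
  have "shannon_entropy M (\<lambda>\<omega>. ()) = 0"
    by (simp add: shannon_entropy_def rv_support_def prob_space)
  then show ?thesis
    using shannon_entropy_submodular[OF assms, of "\<lambda>_. ()" "\<lambda>_. ()"] by simp
qed

section \<open>Conditional measures and the chain rule\<close>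

lemma prob_space_cond_measure:
  assumes "w \<in> rv_support M W"
  shows "prob_space (cond_measure M W w)"
  unfolding cond_measure_def
  using assms by (intro prob_space_uniform_measure) (auto simp: rv_support_def emeasure_eq_measure)

lemma measure_cond_measure:
  assumes "w \<in> rv_support M W" and "B \<in> events"
  shows "measure (cond_measure M W w) B = prob (B \<inter> {\<omega> \<in> space M. W \<omega> = w}) / \<P>(\<omega> in M. W \<omega> = w)"
  unfolding cond_measure_def
  using assms by (subst measure_uniform_measure)
    (auto simp: rv_support_def emeasure_eq_measure Int_commute)

text \<open>The chain rule. Given \<open>W = w\<close> the masses are \<open>p (x, w) / q w\<close>,
  so each logarithm splits into a joint part and a part depending on \<open>w\<close> alone; summing
  over the fibres restores the sum over the joint support.\<close>

lemma cond_shannon_entropy_eq: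
  assumes fin: "finite_rv M (\<lambda>\<omega>. (X \<omega>, W \<omega>))"
  shows "cond_shannon_entropy M X W
    = shannon_entropy M (\<lambda>\<omega>. (X \<omega>, W \<omega>)) - shannon_entropy M W"
proof -
  let ?S = "rv_support M (\<lambda>\<omega>. (X \<omega>, W \<omega>))"
  define p where "p s = \<P>(\<omega> in M. (X \<omega>, W \<omega>) = s)" for s
  define q where "q w = \<P>(\<omega> in M. W \<omega> = w)" for w
  have X: "X \<in> measurable M (count_space UNIV)"
    using finite_rv_comp[OF fin, of fst] by (simp add: finite_rv_def)
  have measX: "{\<omega> \<in> space M. X \<omega> = x} \<in> events" for x
    using measurable_sets[OF X, of "{x}"] by (simp add: vimage_def Int_def conj_commute)
  have SW: "rv_support M W = snd ` ?S"
    using rv_support_comp[OF fin, of snd] by simp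
  have finS: "finite ?S" using fin by (simp add: finite_rv_def)
  have pos: "p s > 0" "q (snd s) > 0" if "s \<in> ?S" for s
  proof -
    show "p s > 0" using that by (simp add: rv_support_def p_def)
    have "snd s \<in> rv_support M W" using that by (simp add: SW)
    then show "q (snd s) > 0" by (simp add: rv_support_def q_def)
  qed
  have "q w * shannon_entropy (cond_measure M W w) X
      = (\<Sum>s | s \<in> ?S \<and> snd s = w. p s * ln (1 / p s) - p s * ln (1 / q (snd s)))"
    if w: "w \<in> rv_support M W" for w
  proof -
    have qw: "q w > 0" using w by (simp add: rv_support_def q_def)
    have "{\<omega> \<in> space (cond_measure M W w). P \<omega>} = {\<omega> \<in> space M. P \<omega>}" for P
      by (simp add: cond_measure_def)
    then have cp: "\<P>(\<omega> in cond_measure M W w. X \<omega> = x) = p (x, w) / q w" for x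
      using measure_cond_measure[OF w measX, of x]
      by (simp add: p_def q_def Int_def conj_ac)
    have supp: "rv_support (cond_measure M W w) X = {x. (x, w) \<in> ?S}"
      using qw by (simp add: rv_support_def cp zero_less_divide_iff) (simp add: p_def)
    have "q w * shannon_entropy (cond_measure M W w) X
        = (\<Sum>x | (x, w) \<in> ?S. p (x, w) * ln (1 / p (x, w)) - p (x, w) * ln (1 / q w))"
      unfolding shannon_entropy_def supp cp sum_distrib_left
    proof (rule sum.cong[OF refl])
      fix x assume "x \<in> {x. (x, w) \<in> ?S}"
      then have "p (x, w) > 0" using pos(1) by auto
      then show "q w * (p (x, w) / q w * ln (1 / (p (x, w) / q w)))
          = p (x, w) * ln (1 / p (x, w)) - p (x, w) * ln (1 / q w)"
        using qw by (simp add: ln_div algebra_simps)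
    qed
    also have "\<dots> = (\<Sum>s | s \<in> ?S \<and> snd s = w. p s * ln (1 / p s) - p s * ln (1 / q (snd s)))"
      by (rule sum.reindex_bij_witness[where i = fst and j = "\<lambda>x. (x, w)"]) auto
    finally show ?thesis .
  qed
  then have "cond_shannon_entropy M X W
      = (\<Sum>w\<in>snd ` ?S. \<Sum>s | s \<in> ?S \<and> snd s = w. p s * ln (1 / p s) - p s * ln (1 / q (snd s)))"
    unfolding cond_shannon_entropy_def SW q_def[symmetric] by (rule sum.cong[OF refl])
  also have "\<dots> = (\<Sum>s\<in>?S. p s * ln (1 / p s) - p s * ln (1 / q (snd s)))"
    by (rule sum.image_gen[OF finS, symmetric])
  also have "\<dots> = shannon_entropy M (\<lambda>\<omega>. (X \<omega>, W \<omega>)) - shannon_entropy M W"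
    using shannon_entropy_comp[OF fin, of snd]
    by (simp add: sum_subtractf shannon_entropy_def[of M "\<lambda>\<omega>. (X \<omega>, W \<omega>)"] p_def q_def)
  finally show ?thesis .
qed

section \<open>Conditional independence and its effect on entropy\<close>

text \<open>Clearing the denominators leaves an identity in the original measure. At values
  \<open>w\<close> of probability zero it reads 0 = 0, so it may be stated for every
  \<open>w\<close>.\<close>

lemma cond_indep_iff:
  assumes A: "A \<in> measurable M (count_space UNIV)" and B: "B \<in> measurable M (count_space UNIV)"
    and W: "W \<in> measurable M (count_space UNIV)"
  shows "cond_indep M A B W \<longleftrightarrow> (\<forall>w S T.
    \<P>(\<omega> in M. A \<omega> \<in> S \<and> B \<omega> \<in> T \<and> W \<omega> = w) * \<P>(\<omega> in M. W \<omega> = w)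
    = \<P>(\<omega> in M. A \<omega> \<in> S \<and> W \<omega> = w) * \<P>(\<omega> in M. B \<omega> \<in> T \<and> W \<omega> = w))"
    (is "_ \<longleftrightarrow> (\<forall>w. ?R w)")
proof -
  have mA: "A -` S \<inter> space M \<in> events" for S using measurable_sets[OF A] by simp
  have mB: "B -` S \<inter> space M \<in> events" for S using measurable_sets[OF B] by simp
  have mW: "{\<omega> \<in> space M. W \<omega> = w} \<in> events" for w
    using measurable_sets[OF W, of "{w}"] by (simp add: vimage_def Int_def conj_commute)
  have R0: "?R w" if "w \<notin> rv_support M W" for w
  proof -
    have "\<P>(\<omega> in M. W \<omega> = w) = 0"
      using that by (auto simp: rv_support_def not_less measure_le_0_iff)
    moreover from this have "\<P>(\<omega> in M. A \<omega> \<in> S \<and> W \<omega> = w) = 0" for S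
      using finite_measure_mono[OF _ mW, of "{\<omega> \<in> space M. A \<omega> \<in> S \<and> W \<omega> = w}" w]
      by (auto simp: measure_le_0_iff)
    ultimately show ?thesis by simp
  qed
  have "indep_rvs (cond_measure M W w) A B \<longleftrightarrow> ?R w" if w: "w \<in> rv_support M W" for w
  proof -
    interpret C: prob_space "cond_measure M W w" by (rule prob_space_cond_measure[OF w])
    have qw: "\<P>(\<omega> in M. W \<omega> = w) > 0" using w by (simp add: rv_support_def)
    have sp: "space (cond_measure M W w) = space M" "C.events = events"
      by (simp_all add: cond_measure_def)
    have cA: "C.prob (A -` S \<inter> space M) = \<P>(\<omega> in M. A \<omega> \<in> S \<and> W \<omega> = w) / \<P>(\<omega> in M. W \<omega> = w)" for S
      unfolding measure_cond_measure[OF w mA]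
      by (auto intro!: arg_cong[where f = prob])
    have cB: "C.prob (B -` T \<inter> space M) = \<P>(\<omega> in M. B \<omega> \<in> T \<and> W \<omega> = w) / \<P>(\<omega> in M. W \<omega> = w)" for T
      unfolding measure_cond_measure[OF w mB]
      by (auto intro!: arg_cong[where f = prob])
    have cAB: "C.prob ((A -` S \<inter> space M) \<inter> (B -` T \<inter> space M))
        = \<P>(\<omega> in M. A \<omega> \<in> S \<and> B \<omega> \<in> T \<and> W \<omega> = w) / \<P>(\<omega> in M. W \<omega> = w)" for S T
      unfolding measure_cond_measure[OF w sets.Int[OF mA mB]]
      by (auto intro!: arg_cong[where f = prob])
    have "indep_rvs (cond_measure M W w) A B \<longleftrightarrow>
        (\<forall>S T. C.prob ((A -` S \<inter> space M) \<inter> (B -` T \<inter> space M))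
          = C.prob (A -` S \<inter> space M) * C.prob (B -` T \<inter> space M))"
      unfolding indep_rvs_def C.indep_sets2_eq sp using mA mB by blast
    also have "\<dots> \<longleftrightarrow> ?R w"
      unfolding cA cB cAB using qw by (simp add: field_simps)
    finally show ?thesis .
  qed
  then show ?thesis unfolding cond_indep_def using R0 by blast
qed

text \<open>The weak union law, with the two sides also exchanged. Given \<open>W = w\<close>, the
  event \<open>A \<in> T\<close> scales the masses of \<open>B \<in> S, V = v\<close> and of
  \<open>V = v\<close> by the same factor, so further conditioning on \<open>V = v\<close> keeps
  \<open>B\<close> independent of \<open>A\<close>.\<close>

lemma cond_indep_weak_union:
  assumes A: "A \<in> measurable M (count_space UNIV)"
    and BV: "(\<lambda>\<omega>. (B \<omega>, V \<omega>)) \<in> measurable M (count_space UNIV)"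
    and WV: "(\<lambda>\<omega>. (W \<omega>, V \<omega>)) \<in> measurable M (count_space UNIV)"
    and ind: "cond_indep M A (\<lambda>\<omega>. (B \<omega>, V \<omega>)) W"
  shows "cond_indep M B A (\<lambda>\<omega>. (W \<omega>, V \<omega>))"
proof -
  have B: "B \<in> measurable M (count_space UNIV)" and W: "W \<in> measurable M (count_space UNIV)"
    using measurable_compose[OF BV, of fst "count_space UNIV"]
      measurable_compose[OF WV, of fst "count_space UNIV"] by simp_all
  show ?thesis
    unfolding cond_indep_iff[OF B A WV]
  proof (intro allI, clarify)
    fix w v S T
    \<comment> \<open>The set \<open>S' \<times> {v}\<close> freezes the value of \<open>V\<close>;
      the instances \<open>S' = S\<close> and \<open>S' = UNIV\<close> are combined below.\<close>
    have E: "\<P>(\<omega> in M. A \<omega> \<in> T \<and> B \<omega> \<in> S' \<and> V \<omega> = v \<and> W \<omega> = w) * \<P>(\<omega> in M. W \<omega> = w)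
      = \<P>(\<omega> in M. A \<omega> \<in> T \<and> W \<omega> = w) * \<P>(\<omega> in M. B \<omega> \<in> S' \<and> V \<omega> = v \<and> W \<omega> = w)" for S'
      using ind[unfolded cond_indep_iff[OF A BV W], rule_format, of T "S' \<times> {v}" w]
      by (simp add: conj_ac)
    show "\<P>(\<omega> in M. B \<omega> \<in> S \<and> A \<omega> \<in> T \<and> (W \<omega>, V \<omega>) = (w, v)) * \<P>(\<omega> in M. (W \<omega>, V \<omega>) = (w, v))
      = \<P>(\<omega> in M. B \<omega> \<in> S \<and> (W \<omega>, V \<omega>) = (w, v)) * \<P>(\<omega> in M. A \<omega> \<in> T \<and> (W \<omega>, V \<omega>) = (w, v))"
    proof (cases "\<P>(\<omega> in M. W \<omega> = w) = 0")
      case True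
      have mW: "{\<omega> \<in> space M. W \<omega> = w} \<in> events"
        using measurable_sets[OF W, of "{w}"] by (simp add: vimage_def Int_def conj_commute)
      have "\<P>(\<omega> in M. P \<omega> \<and> (W \<omega>, V \<omega>) = (w, v)) = 0" for P
        using finite_measure_mono[OF _ mW, of "{\<omega> \<in> space M. P \<omega> \<and> (W \<omega>, V \<omega>) = (w, v)}"] True
        by (auto simp: measure_le_0_iff)
      from this[of "\<lambda>_. True"] this[of "\<lambda>\<omega>. B \<omega> \<in> S"] show ?thesis by simp
    next
      case False
      \<comment> \<open>Here \<open>q\<close> is the probability of \<open>W = w\<close> and
        \<open>\<alpha>\<close> that of \<open>A \<in> T, W = w\<close>. Both instances of
        \<open>E\<close> contain these two numbers; \<open>\<alpha>\<close> is eliminated and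
        \<open>q\<close> divided out.\<close>
      have cancel: "x * d = \<beta> * c"
        if "x * q = \<alpha> * \<beta>" "c * q = \<alpha> * d" "q \<noteq> 0" for x d \<beta> c q \<alpha> :: real
      proof -
        have "(x * d) * q = (\<alpha> * \<beta>) * d" by (simp flip: that(1))
        also have "\<dots> = (\<beta> * c) * q" using that(2) by (simp add: mult_ac)
        finally show ?thesis using that(3) by simp
      qed
      show ?thesis
        using cancel[OF E[of S] _ False] E[of UNIV] by (simp add: conj_ac)
    qed
  qed
qed

lemma cond_indep_comp:
  assumes A: "A \<in> measurable M (count_space UNIV)" and B: "B \<in> measurable M (count_space UNIV)"
    and W: "W \<in> measurable M (count_space UNIV)"
    and ind: "cond_indep M A B W"
  shows "cond_indep M A (\<lambda>\<omega>. f (B \<omega>)) W"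
proof -
  have fB: "(\<lambda>\<omega>. f (B \<omega>)) \<in> measurable M (count_space UNIV)"
    using measurable_compose[OF B, of f] by simp
  show ?thesis
    unfolding cond_indep_iff[OF A fB W]
    using ind[unfolded cond_indep_iff[OF A B W], rule_format, of _ "f -` _"] by simp
qed

text \<open>Conditional independence says \<open>p * q = pa * pb\<close> pointwise. Taking
  logarithms and averaging over the joint law gives the entropy identity, all four entropies being
  written as sums over the same support.\<close>

lemma shannon_entropy_cond_indep:
  assumes fin: "finite_rv M (\<lambda>\<omega>. (A \<omega>, B \<omega>, W \<omega>))" and ind: "cond_indep M A B W"
  shows "shannon_entropy M (\<lambda>\<omega>. (A \<omega>, B \<omega>, W \<omega>)) + shannon_entropy M W
    = shannon_entropy M (\<lambda>\<omega>. (A \<omega>, W \<omega>)) + shannon_entropy M (\<lambda>\<omega>. (B \<omega>, W \<omega>))"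
proof -
  let ?S = "rv_support M (\<lambda>\<omega>. (A \<omega>, B \<omega>, W \<omega>))"
  have fA: "finite_rv M A" and fB: "finite_rv M B" and fW: "finite_rv M W"
    using finite_rv_comp[OF fin, of fst] finite_rv_comp[OF fin, of "\<lambda>(a, b, w). b"]
      finite_rv_comp[OF fin, of "\<lambda>(a, b, w). w"] by simp_all
  then have mA: "A \<in> measurable M (count_space UNIV)" and mB: "B \<in> measurable M (count_space UNIV)"
    and mW: "W \<in> measurable M (count_space UNIV)" by (simp_all add: finite_rv_def)
  define p where "p a b w = \<P>(\<omega> in M. A \<omega> = a \<and> B \<omega> = b \<and> W \<omega> = w)" for a b w
  define pa where "pa a w = \<P>(\<omega> in M. A \<omega> = a \<and> W \<omega> = w)" for a w
  define pb where "pb b w = \<P>(\<omega> in M. B \<omega> = b \<and> W \<omega> = w)" for b w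
  define q where "q w = \<P>(\<omega> in M. W \<omega> = w)" for w
  have eq: "p a b w * q w = pa a w * pb b w" for a b w
    using ind[unfolded cond_indep_iff[OF mA mB mW], rule_format, of "{a}" "{b}" w]
    by (simp add: p_def pa_def pb_def q_def)
  have H: "shannon_entropy M (\<lambda>\<omega>. (A \<omega>, B \<omega>, W \<omega>)) = (\<Sum>(a, b, w)\<in>?S. p a b w * ln (1 / p a b w))"
    by (simp add: shannon_entropy_def p_def split_def prod_eq_iff)
  have HA: "shannon_entropy M (\<lambda>\<omega>. (A \<omega>, W \<omega>)) = (\<Sum>(a, b, w)\<in>?S. p a b w * ln (1 / pa a w))"
    using shannon_entropy_comp[OF fin, of "\<lambda>(a, b, w). (a, w)"]
    by (simp add: p_def pa_def split_def prod_eq_iff)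
  have HB: "shannon_entropy M (\<lambda>\<omega>. (B \<omega>, W \<omega>)) = (\<Sum>(a, b, w)\<in>?S. p a b w * ln (1 / pb b w))"
    using shannon_entropy_comp[OF fin, of "\<lambda>(a, b, w). (b, w)"]
    by (simp add: p_def pb_def split_def prod_eq_iff)
  have HW: "shannon_entropy M W = (\<Sum>(a, b, w)\<in>?S. p a b w * ln (1 / q w))"
    using shannon_entropy_comp[OF fin, of "\<lambda>(a, b, w). w"]
    by (simp add: p_def q_def split_def prod_eq_iff)
  show ?thesis
    unfolding H HA HB HW sum.distrib[symmetric]
  proof (rule sum.cong[OF refl], clarify)
    fix a b w assume s: "(a, b, w) \<in> ?S"
    have p: "p a b w > 0" using s by (simp add: rv_support_def p_def)
    have "w \<in> rv_support M W"
      using s rv_support_comp[OF fin, of "\<lambda>(a, b, w). w"] by force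
    then have q: "q w > 0" by (simp add: rv_support_def q_def)
    \<comment> \<open>Positivity of both marginal masses is read off the product identity; it
      justifies the logarithms.\<close>
    have pp: "pa a w * pb b w > 0" using eq[of a b w] p q by (metis mult_pos_pos)
    have "pa a w \<ge> 0" "pb b w \<ge> 0" by (simp_all add: pa_def pb_def)
    with pp have ab: "pa a w > 0" "pb b w > 0" by (auto simp: zero_less_mult_iff)
    have "ln (p a b w) + ln (q w) = ln (pa a w) + ln (pb b w)"
      using eq[of a b w] p q ab by (metis ln_mult_pos)
    then have "ln (1 / p a b w) + ln (1 / q w) = ln (1 / pa a w) + ln (1 / pb b w)"
      using p q ab by (simp add: ln_div)
    then show "p a b w * ln (1 / p a b w) + p a b w * ln (1 / q w)
        = p a b w * ln (1 / pa a w) + p a b w * ln (1 / pb b w)"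
      by (metis distrib_left)
  qed
qed

end

section \<open>Entropies along the Markov chain and the resulting bounds\<close>

theorem theorem3p1:
  fixes M :: "'w measure" and N :: "'v measure"
    and X Y :: "'w \<Rightarrow> 'g::ab_group_add"
    and X1 X2 Y1 Y' :: "'v \<Rightarrow> 'g"
    and K :: real
  assumes "prob_space M" and "prob_space N"
    and "K \<ge> 1"
    and "finite_rv M (\<lambda>\<omega>. (X \<omega>, Y \<omega>))"
    and "shannon_entropy M (\<lambda>\<omega>. (X \<omega>, Y \<omega>))
           \<ge> shannon_entropy M X + shannon_entropy M Y - ln K"
    and "shannon_entropy M (\<lambda>\<omega>. X \<omega> + Y \<omega>)
           \<le> 1/2 * shannon_entropy M X + 1/2 * shannon_entropy M Y + ln K"
    and "(\<lambda>\<omega>. (X1 \<omega>, X2 \<omega>, Y1 \<omega>, Y' \<omega>)) \<in> measurable N (count_space UNIV)"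
    and "same_law N (\<lambda>\<omega>. (X1 \<omega>, Y1 \<omega>)) M (\<lambda>\<omega>. (X \<omega>, Y \<omega>))"
    and "same_law N (\<lambda>\<omega>. (X2 \<omega>, Y1 \<omega>)) M (\<lambda>\<omega>. (X \<omega>, Y \<omega>))"
    and "cond_indep N X1 X2 Y1"
    and "same_law N (\<lambda>\<omega>. (X1 \<omega>, Y' \<omega>)) N (\<lambda>\<omega>. (X1 \<omega>, Y1 \<omega>))"
    and "cond_indep N Y' (\<lambda>\<omega>. (X2 \<omega>, Y1 \<omega>)) X1"
  shows "cond_indep N X2 Y' (\<lambda>\<omega>. (X1 \<omega>, Y1 \<omega>))
    \<and> cond_shannon_entropy N X2 (\<lambda>\<omega>. (X1 \<omega>, Y1 \<omega>)) \<ge> shannon_entropy M X - ln K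
    \<and> cond_shannon_entropy N Y' (\<lambda>\<omega>. (X1 \<omega>, Y1 \<omega>)) \<ge> shannon_entropy M Y - ln K
    \<and> cond_shannon_entropy N (\<lambda>\<omega>. X2 \<omega> + Y' \<omega>) (\<lambda>\<omega>. (X1 \<omega>, Y1 \<omega>))
        \<le> 1/2 * shannon_entropy M X + 1/2 * shannon_entropy M Y + 7 * ln K"
proof -
  interpret M: prob_space M by fact
  interpret N: prob_space N by fact
  let ?H = "shannon_entropy M" and ?h = "shannon_entropy N"
  note mQ = assms(7)
  have mX: "(\<lambda>\<omega>. (X \<omega>, Y \<omega>)) \<in> measurable M (count_space UNIV)"
    using assms(4) by (simp add: finite_rv_def)
  have m: "(\<lambda>\<omega>. f (X1 \<omega>, X2 \<omega>, Y1 \<omega>, Y' \<omega>)) \<in> measurable N (count_space UNIV)" for f :: "_ \<Rightarrow> 'z"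
    using measurable_compose[OF mQ, of f] by simp
  have m1: "X1 \<in> measurable N (count_space UNIV)" and m4: "Y' \<in> measurable N (count_space UNIV)"
    and m13: "(\<lambda>\<omega>. (X1 \<omega>, Y1 \<omega>)) \<in> measurable N (count_space UNIV)"
    and m23: "(\<lambda>\<omega>. (X2 \<omega>, Y1 \<omega>)) \<in> measurable N (count_space UNIV)"
    and m14: "(\<lambda>\<omega>. (X1 \<omega>, Y' \<omega>)) \<in> measurable N (count_space UNIV)"
    using m[of "\<lambda>(a, b, c, d). a"] m[of "\<lambda>(a, b, c, d). d"] m[of "\<lambda>(a, b, c, d). (a, c)"]
      m[of "\<lambda>(a, b, c, d). (b, c)"] m[of "\<lambda>(a, b, c, d). (a, d)"] by simp_all
  have f13: "finite_rv N (\<lambda>\<omega>. (X1 \<omega>, Y1 \<omega>))" and f23: "finite_rv N (\<lambda>\<omega>. (X2 \<omega>, Y1 \<omega>))"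
    using N.finite_rv_same_law[OF assms(1,4)] m13 m23 assms(8,9) by blast+
  have f14: "finite_rv N (\<lambda>\<omega>. (X1 \<omega>, Y' \<omega>))"
    by (rule N.finite_rv_same_law[OF assms(2) f13 m14 assms(11)])
  have fQ: "finite_rv N (\<lambda>\<omega>. (X1 \<omega>, X2 \<omega>, Y1 \<omega>, Y' \<omega>))"
  proof (rule N.finite_rvI[OF mQ])
    \<comment> \<open>The pairs \<open>(X2, Y1)\<close> and \<open>(X1, Y')\<close> together contain
      all four variables and are already known to be finite, so the rearranged product of their
      supports carries the quadruple.\<close>
    let ?F = "(\<lambda>((b, c), (a, d)). (a, b, c, d)) `
      (rv_support N (\<lambda>\<omega>. (X2 \<omega>, Y1 \<omega>)) \<times> rv_support N (\<lambda>\<omega>. (X1 \<omega>, Y' \<omega>)))"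
    show "finite ?F" using f23 f14 by (simp add: finite_rv_def)
    have "AE \<omega> in N. (X2 \<omega>, Y1 \<omega>) \<in> rv_support N (\<lambda>\<omega>. (X2 \<omega>, Y1 \<omega>))"
      "AE \<omega> in N. (X1 \<omega>, Y' \<omega>) \<in> rv_support N (\<lambda>\<omega>. (X1 \<omega>, Y' \<omega>))"
      using f23 f14 by (simp_all add: finite_rv_def)
    then show "AE \<omega> in N. (X1 \<omega>, X2 \<omega>, Y1 \<omega>, Y' \<omega>) \<in> ?F"
      by eventually_elim force
  qed
  have f: "finite_rv N (\<lambda>\<omega>. g (X1 \<omega>, X2 \<omega>, Y1 \<omega>, Y' \<omega>))" for g :: "_ \<Rightarrow> 'z"
    by (rule N.finite_rv_comp[OF fQ])

  have h13: "?h (\<lambda>\<omega>. g (X1 \<omega>, Y1 \<omega>)) = ?H (\<lambda>\<omega>. g (X \<omega>, Y \<omega>))" for g :: "_ \<Rightarrow> 'z"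
    by (rule same_law_shannon_entropy[OF m13 mX assms(8)])
  have h23: "?h (\<lambda>\<omega>. g (X2 \<omega>, Y1 \<omega>)) = ?H (\<lambda>\<omega>. g (X \<omega>, Y \<omega>))" for g :: "_ \<Rightarrow> 'z"
    by (rule same_law_shannon_entropy[OF m23 mX assms(9)])
  have h14: "?h (\<lambda>\<omega>. g (X1 \<omega>, Y' \<omega>)) = ?H (\<lambda>\<omega>. g (X \<omega>, Y \<omega>))" for g :: "_ \<Rightarrow> 'z"
    using same_law_shannon_entropy[OF m14 m13 assms(11)] h13 by metis
  have law: "?h X1 = ?H X" "?h X2 = ?H X" "?h Y1 = ?H Y" "?h Y' = ?H Y"
    using h13[of fst] h23[of fst] h13[of snd] h14[of snd] by simp_all
  \<comment> \<open>Every edge of the chain \<open>X2 - Y1 - X1 - Y'\<close> is a copy of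
    \<open>(X, Y)\<close>, up to order, and so has entropy \<open>J\<close>.\<close>
  define J where "J = ?H (\<lambda>\<omega>. (X \<omega>, Y \<omega>))"
  have pair: "?h (\<lambda>\<omega>. (X1 \<omega>, Y1 \<omega>)) = J" "?h (\<lambda>\<omega>. (X2 \<omega>, Y1 \<omega>)) = J"
    "?h (\<lambda>\<omega>. (Y' \<omega>, X1 \<omega>)) = J" "?h (\<lambda>\<omega>. (Y1 \<omega>, X1 \<omega>)) = J"
    using h13[of id] h23[of id] h14[of prod.swap] h13[of prod.swap]
      shannon_entropy_inj[of prod.swap M "\<lambda>\<omega>. (X \<omega>, Y \<omega>)"] by (simp_all add: J_def)
  have sums: "?h (\<lambda>\<omega>. X1 \<omega> + Y1 \<omega>) = ?H (\<lambda>\<omega>. X \<omega> + Y \<omega>)"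
    "?h (\<lambda>\<omega>. X2 \<omega> + Y1 \<omega>) = ?H (\<lambda>\<omega>. X \<omega> + Y \<omega>)"
    "?h (\<lambda>\<omega>. X1 \<omega> + Y' \<omega>) = ?H (\<lambda>\<omega>. X \<omega> + Y \<omega>)"
    using h13[of "\<lambda>(x, y). x + y"] h23[of "\<lambda>(x, y). x + y"] h14[of "\<lambda>(x, y). x + y"] by simp_all

  \<comment> \<open>Weak union moves \<open>Y1\<close> from the pair \<open>(X2, Y1)\<close> into
    the condition \<open>X1\<close>.\<close>
  have indep: "cond_indep N X2 Y' (\<lambda>\<omega>. (X1 \<omega>, Y1 \<omega>))"
    by (rule N.cond_indep_weak_union[OF m4 m23 m13 assms(12)])
  have indep': "cond_indep N Y' Y1 X1"
    using N.cond_indep_comp[OF m4 m23 m1 assms(12), of snd] by simp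

  \<comment> \<open>Two edges glued at the vertex \<open>Y1\<close>: the entropies of the edges add
    up, less that of the shared vertex.\<close>
  have h123: "?h (\<lambda>\<omega>. (X1 \<omega>, X2 \<omega>, Y1 \<omega>)) + ?H Y = 2 * J"
    using N.shannon_entropy_cond_indep[OF _ assms(10)] f[of "\<lambda>(a, b, c, d). (a, b, c)"]
    by (simp add: law pair)
  have "?h (\<lambda>\<omega>. (X2 \<omega>, X1 \<omega>, Y1 \<omega>)) = ?h (\<lambda>\<omega>. (X1 \<omega>, X2 \<omega>, Y1 \<omega>))"
    using shannon_entropy_inj[of "\<lambda>(a, b, c). (b, a, c)" N "\<lambda>\<omega>. (X1 \<omega>, X2 \<omega>, Y1 \<omega>)"]
    by (simp add: inj_def)
  then have 1: "cond_shannon_entropy N X2 (\<lambda>\<omega>. (X1 \<omega>, Y1 \<omega>)) = J - ?H Y"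
    using N.cond_shannon_entropy_eq[of X2 "\<lambda>\<omega>. (X1 \<omega>, Y1 \<omega>)"] f[of "\<lambda>(a, b, c, d). (b, a, c)"] h123
    by (simp add: pair)

  \<comment> \<open>The same gluing for the subchain \<open>Y1 - X1 - Y'\<close>, now at the vertex
    \<open>X1\<close>.\<close>
  have "?h (\<lambda>\<omega>. (Y' \<omega>, Y1 \<omega>, X1 \<omega>)) + ?H X = 2 * J"
    using N.shannon_entropy_cond_indep[OF _ indep'] f[of "\<lambda>(a, b, c, d). (d, c, a)"]
    by (simp add: law pair)
  moreover have "?h (\<lambda>\<omega>. (Y' \<omega>, X1 \<omega>, Y1 \<omega>)) = ?h (\<lambda>\<omega>. (Y' \<omega>, Y1 \<omega>, X1 \<omega>))"
    using shannon_entropy_inj[of "\<lambda>(a, b, c). (a, c, b)" N "\<lambda>\<omega>. (Y' \<omega>, Y1 \<omega>, X1 \<omega>)"]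
    by (simp add: inj_def)
  ultimately have 2: "cond_shannon_entropy N Y' (\<lambda>\<omega>. (X1 \<omega>, Y1 \<omega>)) = J - ?H X"
    using N.cond_shannon_entropy_eq[of Y' "\<lambda>\<omega>. (X1 \<omega>, Y1 \<omega>)"] f[of "\<lambda>(a, b, c, d). (d, a, c)"]
    by (simp add: pair)

  \<comment> \<open>The third edge \<open>X1 - Y'\<close> is glued to the triple at
    \<open>X1\<close>, which adds \<open>J\<close> and removes the entropy of
    \<open>X\<close>.\<close>
  have "?h (\<lambda>\<omega>. (Y' \<omega>, (X2 \<omega>, Y1 \<omega>), X1 \<omega>)) + ?H X
      = J + ?h (\<lambda>\<omega>. ((X2 \<omega>, Y1 \<omega>), X1 \<omega>))"
    using N.shannon_entropy_cond_indep[OF _ assms(12)] f[of "\<lambda>(a, b, c, d). (d, (b, c), a)"]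
    by (simp add: law pair)
  moreover have "?h (\<lambda>\<omega>. ((X2 \<omega>, Y1 \<omega>), X1 \<omega>)) = ?h (\<lambda>\<omega>. (X1 \<omega>, X2 \<omega>, Y1 \<omega>))"
    using shannon_entropy_inj[of prod.swap N "\<lambda>\<omega>. (X1 \<omega>, X2 \<omega>, Y1 \<omega>)"] by simp
  ultimately have hQ: "?h (\<lambda>\<omega>. (Y' \<omega>, (X2 \<omega>, Y1 \<omega>), X1 \<omega>)) = 3 * J - ?H X - ?H Y"
    using h123 by simp

  let ?U = "\<lambda>\<omega>. (X2 \<omega> + Y1 \<omega>, X1 \<omega> + Y1 \<omega>, X1 \<omega> + Y' \<omega>)" and ?V = "\<lambda>\<omega>. (X2 \<omega>, Y' \<omega>)"
  \<comment> \<open>\<open>X2\<close> and \<open>Y'\<close> are given outright; then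
    \<open>Y1\<close> is recovered from \<open>X2 + Y1\<close> and \<open>X1\<close> from
    \<open>X1 + Y'\<close>.\<close>
  have inj: "inj (\<lambda>(d, (b, c), a). ((b + c, a + c, a + d), (b, d)) ::
      ('g \<times> 'g \<times> 'g) \<times> 'g \<times> 'g)"
    by (auto simp: inj_def)
  have hUV: "?h (\<lambda>\<omega>. (?U \<omega>, ?V \<omega>)) = 3 * J - ?H X - ?H Y"
    using shannon_entropy_inj[OF inj, of N "\<lambda>\<omega>. (Y' \<omega>, (X2 \<omega>, Y1 \<omega>), X1 \<omega>)"] hQ by simp
  have "?h (\<lambda>\<omega>. (?U \<omega>, ?V \<omega>)) + ?h (\<lambda>\<omega>. (\<lambda>(r, s, t). r - s + t) (?U \<omega>)) \<le> ?h ?U + ?h ?V"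
    by (rule N.shannon_entropy_submodular[where b = "\<lambda>(x, y). x + y"])
      (use f[of "\<lambda>(a, b, c, d). ((b + c, a + c, a + d), (b, d))"] in \<open>simp_all add: algebra_simps\<close>)
  then have sub: "3 * J - ?H X - ?H Y + ?h (\<lambda>\<omega>. X2 \<omega> + Y' \<omega>) \<le> ?h ?U + ?h ?V"
    unfolding hUV by (simp add: algebra_simps)
  \<comment> \<open>Each coordinate of \<open>?U\<close> is the sum along an edge of the chain,
    hence distributed as \<open>X + Y\<close>; subadditivity is applied twice.\<close>
  have "?h ?U \<le> ?h (\<lambda>\<omega>. X2 \<omega> + Y1 \<omega>) + ?h (\<lambda>\<omega>. (X1 \<omega> + Y1 \<omega>, X1 \<omega> + Y' \<omega>))"
    by (rule N.shannon_entropy_subadditive)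
      (use f[of "\<lambda>(a, b, c, d). (b + c, a + c, a + d)"] in simp)
  moreover have "?h (\<lambda>\<omega>. (X1 \<omega> + Y1 \<omega>, X1 \<omega> + Y' \<omega>))
      \<le> ?h (\<lambda>\<omega>. X1 \<omega> + Y1 \<omega>) + ?h (\<lambda>\<omega>. X1 \<omega> + Y' \<omega>)"
    by (rule N.shannon_entropy_subadditive)
      (use f[of "\<lambda>(a, b, c, d). (a + c, a + d)"] in simp)
  ultimately have U: "?h ?U \<le> 3 * ?H (\<lambda>\<omega>. X \<omega> + Y \<omega>)"
    by (simp add: sums)
  have V: "?h ?V \<le> ?H X + ?H Y"
    using N.shannon_entropy_subadditive[of X2 Y'] f[of "\<lambda>(a, b, c, d). (b, d)"] by (simp add: law)
  \<comment> \<open>Conditioning does not increase entropy: the chain rule combined with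
    subadditivity.\<close>
  have fZ: "finite_rv N (\<lambda>\<omega>. (X2 \<omega> + Y' \<omega>, (X1 \<omega>, Y1 \<omega>)))"
    using f[of "\<lambda>(a, b, c, d). (b + d, (a, c))"] by simp
  have 3: "cond_shannon_entropy N (\<lambda>\<omega>. X2 \<omega> + Y' \<omega>) (\<lambda>\<omega>. (X1 \<omega>, Y1 \<omega>)) \<le> ?h (\<lambda>\<omega>. X2 \<omega> + Y' \<omega>)"
    using N.cond_shannon_entropy_eq[OF fZ] N.shannon_entropy_subadditive[OF fZ] by simp
  \<comment> \<open>Inserting \<open>U\<close> and \<open>V\<close> into \<open>sub\<close> bounds
    the entropy of \<open>X2 + Y'\<close> by three times that of \<open>X + Y\<close>, plus twice
    those of \<open>X\<close> and \<open>Y\<close>, minus \<open>3 * J\<close>. The two entropy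
    hypotheses, each used three times, turn this into half the sum of the entropies of
    \<open>X\<close> and \<open>Y\<close> plus \<open>6 * ln K\<close>; nonnegativity of
    \<open>ln K\<close> relaxes 6 to 7.\<close>
  have "ln K \<ge> 0" using assms(3) by simp
  then show ?thesis
    using indep 1 2 3 sub U V assms(5,6) unfolding J_def by simp
qed

end
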